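(* Let $\omega_1,\omega_2$ be non-zero complex numbers with $\mathrm{Im}(\omega_2/\omega_1)>0$, and let $H(s)=\dfrac{s}{\sin(\omega_1 s)\sin(\omega_2 s)}$. For $n\in\mathbb{N}$ let $C_n$ be the closed polygonal contour joining by segments, in counterclockwise direction, the points $(n+\tfrac12)\pi(\omega_1^{-1}-\omega_2^{-1})$, $(n+\tfrac12)\pi(-\omega_1^{-1}-\omega_2^{-1})$, $(n+\tfrac12)\pi(-\omega_1^{-1}+\omega_2^{-1})$ and $(n+\tfrac12)\pi(\omega_1^{-1}+\omega_2^{-1})$. Then for every $z\in\,]-\tfrac12,\tfrac12[\,\omega_1+\,]-\tfrac12,\tfrac12[\,\omega_2$, $$\lim_{n\to+\infty}\int_{C_n}H(s)e^{2isz}\,ds=0.$$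
   Context: $]-\tfrac12,\tfrac12[$ denotes the open real interval, and $]-\tfrac12,\tfrac12[\,\omega_1+\,]-\tfrac12,\tfrac12[\,\omega_2=\{a\omega_1+b\omega_2:\ a,b\in\mathbb{R},\ |a|<\tfrac12,\ |b|<\tfrac12\}$. *)

theory Defs
  imports "HOL-Complex_Analysis.Complex_Analysis"
begin

definition H :: "complex \<Rightarrow> complex \<Rightarrow> complex \<Rightarrow> complex" where
  "H \<omega>1 \<omega>2 s = s / (sin (\<omega>1 * s) * sin (\<omega>2 * s))"

text \<open>
  The vertices are listed in the order of traversal. Since \<open>Im (\<omega>2 / \<omega>1) > 0\<close>, the pair
  \<open>(1 / \<omega>1, 1 / \<omega>2)\<close> is negatively oriented, so this order is counterclockwise.
\<close>

definition C :: "complex \<Rightarrow> complex \<Rightarrow> nat \<Rightarrow> real \<Rightarrow> complex" where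
  "C \<omega>1 \<omega>2 n =
    (let r = of_real ((real n + 1/2) * pi);
         p1 = r * (inverse \<omega>1 - inverse \<omega>2);
         p2 = r * (- inverse \<omega>1 - inverse \<omega>2);
         p3 = r * (- inverse \<omega>1 + inverse \<omega>2);
         p4 = r * (inverse \<omega>1 + inverse \<omega>2)
     in linepath p1 p2 +++ linepath p2 p3 +++ linepath p3 p4 +++ linepath p4 p1)"

definition open_cell :: "complex \<Rightarrow> complex \<Rightarrow> complex set" where
  "open_cell \<omega>1 \<omega>2 =
    {of_real a * \<omega>1 + of_real b * \<omega>2 | a b :: real. a \<in> {-1/2<..<1/2} \<and> b \<in> {-1/2<..<1/2}}"

end

theory Submission
  imports Defs "HOL-Real_Asymp.Real_Asymp"
begin

text \<open>
  Write \<open>z = a * \<omega>1 + b * \<omega>2\<close>. Then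
  \<open>norm (exp (2 * \<i> * s * z)) \<le> exp (2 * \<bar>a\<bar> * \<bar>Im (\<omega>1 * s)\<bar> + 2 * \<bar>b\<bar> * \<bar>Im (\<omega>2 * s)\<bar>)\<close>, while
  \<open>norm (sin w)\<close> is comparable to \<open>exp \<bar>Im w\<bar>\<close> away from the zeros of the sine. On each side of the
  contour one of \<open>\<omega>1 * s\<close>, \<open>\<omega>2 * s\<close> has imaginary part of size proportional to \<open>n\<close>, and the other
  runs along a line through an odd multiple of \<open>pi / 2\<close> that meets the real axis nowhere else.
  As \<open>2 * \<bar>a\<bar> < 1\<close> and \<open>2 * \<bar>b\<bar> < 1\<close>, the integrand decays exponentially in \<open>n\<close>, which beats the
  linear growth of the factor \<open>s\<close> and of the length of the side.
\<close>

section \<open>Lower bounds for sine and cosine\<close>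

text \<open>Up to a unit factor, \<open>sin w\<close> is half the difference of two exponentials
  with moduli \<open>exp (- Im w)\<close> and \<open>exp (Im w)\<close>. The reverse triangle
  inequality leaves \<open>sinh \<bar>Im w\<bar>\<close>, and the assumption makes its decaying part
  a fixed fraction of the growing one.\<close>

lemma norm_sin_ge_exp_abs_Im:
  fixes w :: complex
  assumes "\<delta> \<le> \<bar>Im w\<bar>"
  shows "(1 - exp (- 2 * \<delta>)) / 2 * exp \<bar>Im w\<bar> \<le> norm (sin w)"
proof -
  have "exp (- \<bar>Im w\<bar>) = exp (- 2 * \<bar>Im w\<bar>) * exp \<bar>Im w\<bar>"
    by (simp add: exp_add [symmetric])
  also have "\<dots> \<le> exp (- 2 * \<delta>) * exp \<bar>Im w\<bar>"
    using assms by (intro mult_right_mono) auto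
  finally have "(1 - exp (- 2 * \<delta>)) / 2 * exp \<bar>Im w\<bar> \<le> (exp \<bar>Im w\<bar> - exp (- \<bar>Im w\<bar>)) / 2"
    by (simp add: field_simps)
  also have "\<dots> \<le> \<bar>exp (- Im w) - exp (Im w)\<bar> / 2"
    by (auto simp: abs_if)
  also have "\<dots> = \<bar>norm (exp (\<i> * w)) - norm (exp (- (\<i> * w)))\<bar> / 2"
    by simp
  also have "\<dots> \<le> norm (exp (\<i> * w) - exp (- (\<i> * w))) / 2"
    by (intro divide_right_mono norm_triangle_ineq3) auto
  also have "\<dots> = norm (sin w)"
    by (simp add: sin_exp_eq norm_divide norm_mult)
  finally show ?thesis .
qed

text \<open>All zeros of the cosine are real, and the line through 0 in direction
  \<open>\<tau>\<close> meets the real axis only at 0, where the cosine is 1. Compactness therefore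
  handles a neighbourhood of 0, and the previous bound handles the rest of the line.\<close>

lemma norm_cos_real_multiple_ge_exp_abs_Im:
  fixes \<tau> :: complex
  assumes "Im \<tau> \<noteq> 0"
  obtains k where "k > 0" "\<And>t. k * exp \<bar>Im (of_real t * \<tau>)\<bar> \<le> norm (cos (of_real t * \<tau>))"
proof -
  \<comment> \<open>With this threshold, \<open>\<bar>t\<bar> \<le> T\<close> means exactly that the
    imaginary part of \<open>t * \<tau>\<close> is at most 1 in absolute value.\<close>
  define T where "T = 1 / \<bar>Im \<tau>\<bar>"
  have T: "T > 0" using assms by (simp add: T_def)
  have ne: "{-T..T} \<noteq> {}"
    using T by simp
  have "continuous_on {-T..T} (\<lambda>t. norm (cos (of_real t * \<tau>)))"
    by (intro continuous_intros)
  then obtain t0 where t0: "\<And>t. t \<in> {-T..T} \<Longrightarrow> norm (cos (of_real t0 * \<tau>)) \<le> norm (cos (of_real t * \<tau>))"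
    using continuous_attains_inf [OF compact_Icc ne] by meson
  define m where "m = norm (cos (of_real t0 * \<tau>))"
  have "cos (of_real t0 * \<tau>) \<noteq> 0"
  proof (cases "t0 = 0")
    case False
    show ?thesis
    proof
      assume "cos (of_real t0 * \<tau>) = 0"
      then obtain n :: int where "of_real t0 * \<tau> = of_int n * of_real pi + of_real pi / 2"
        by (auto simp: cos_eq_0)
      also have "\<dots> = of_real (of_int n * pi + pi / 2)"
        by simp
      finally have "Im (of_real t0 * \<tau>) = 0"
        by (simp only: Im_complex_of_real)
      with False assms show False
        by simp
    qed
  qed simp
  then have m: "m > 0"
    by (simp add: m_def)
  define c :: real where "c = (1 - exp (- 2 * 1)) / 2"
  have c: "c > 0"
    by (simp add: c_def)
  \<comment> \<open>The factor \<open>exp (- 1)\<close> compensates for the growth of the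
    exponential up to \<open>exp 1\<close> on the compact part; \<open>c\<close> is the constant of
    the sine bound for \<delta> = 1.\<close>
  define k where "k = min (m * exp (- 1)) c"
  show ?thesis
  proof
    show "k > 0"
      using m c by (simp add: k_def)
    fix t :: real
    have y: "\<bar>Im (of_real t * \<tau>)\<bar> = \<bar>t\<bar> * \<bar>Im \<tau>\<bar>"
      by (simp add: abs_mult)
    show "k * exp \<bar>Im (of_real t * \<tau>)\<bar> \<le> norm (cos (of_real t * \<tau>))"
    proof (cases "\<bar>t\<bar> \<le> T")
      case True
      then have "\<bar>Im (of_real t * \<tau>)\<bar> \<le> 1"
        using assms unfolding y by (simp add: T_def field_simps)
      then have "k * exp \<bar>Im (of_real t * \<tau>)\<bar> \<le> (m * exp (- 1)) * exp 1"
        using m by (intro mult_mono) (auto simp: k_def)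
      also have "\<dots> = m"
        by (simp add: exp_minus)
      also have "\<dots> \<le> norm (cos (of_real t * \<tau>))"
        unfolding m_def using True by (intro t0) auto
      finally show ?thesis .
    next
      case False
      \<comment> \<open>The real shift by \<open>pi / 2\<close> turns the sine into the cosine and
        leaves the imaginary part unchanged.\<close>
      then have "1 \<le> \<bar>Im (of_real t * \<tau> + of_real pi / 2)\<bar>"
        using assms y by (simp add: T_def field_simps)
      from norm_sin_ge_exp_abs_Im [OF this]
      have "c * exp \<bar>Im (of_real t * \<tau>)\<bar> \<le> norm (sin (of_real t * \<tau> + of_real pi / 2))"
        by (simp add: c_def)
      moreover have "sin (of_real t * \<tau> + of_real pi / 2) = cos (of_real t * \<tau>)"
        by (simp add: sin_cos_eq)
      moreover have "k * exp \<bar>Im (of_real t * \<tau>)\<bar> \<le> c * exp \<bar>Im (of_real t * \<tau>)\<bar>"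
        by (intro mult_right_mono) (auto simp: k_def)
      ultimately show ?thesis
        by (metis order_trans)
    qed
  qed
qed

text \<open>At an odd multiple of \<open>pi / 2\<close> the cosine vanishes and the sine is 1 or -1,
  so the addition formula leaves only \<open>cos w\<close> up to sign.\<close>

lemma norm_sin_half_odd_pi_add:
  fixes w :: complex and e :: real
  assumes "e \<in> {1, -1}"
  shows "norm (sin (of_real (e * ((real n + 1/2) * pi)) + w)) = norm (cos w)"
proof -
  have c: "cos ((real n + 1/2) * pi) = 0"
    by (simp add: ring_distribs cos_add)
  have "sin ((real n + 1/2) * pi) \<in> {1, -1}"
    by (cases "even n") (auto simp: ring_distribs sin_add)
  then have s: "\<bar>sin (e * ((real n + 1/2) * pi))\<bar> = 1"
    using assms by auto
  have c': "cos (e * ((real n + 1/2) * pi)) = 0"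
    using assms c by auto
  show ?thesis
    unfolding sin_add sin_of_real cos_of_real c' using s by (simp add: norm_mult)
qed

section \<open>Integrand and integral on one side of the parallelogram\<close>

lemma norm_exp_cell_le:
  fixes v w s :: complex and a b :: real
  shows "norm (exp (2 * \<i> * s * (of_real a * w + of_real b * v)))
           \<le> exp (2 * \<bar>a\<bar> * \<bar>Im (w * s)\<bar>) * exp (2 * \<bar>b\<bar> * \<bar>Im (v * s)\<bar>)"
proof -
  have "Re (2 * \<i> * s * (of_real a * w + of_real b * v))
          = - 2 * Im (s * (of_real a * w + of_real b * v))"
    by simp
  also have "Im (s * (of_real a * w + of_real b * v)) = a * Im (w * s) + b * Im (v * s)"
    by (simp add: algebra_simps)
  also have "- 2 * (a * Im (w * s) + b * Im (v * s)) = - 2 * (a * Im (w * s)) - 2 * (b * Im (v * s))"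
    by simp
  also have "\<dots> \<le> 2 * \<bar>a * Im (w * s)\<bar> + 2 * \<bar>b * Im (v * s)\<bar>"
    by arith
  also have "\<dots> = 2 * \<bar>a\<bar> * \<bar>Im (w * s)\<bar> + 2 * \<bar>b\<bar> * \<bar>Im (v * s)\<bar>"
    by (simp add: abs_mult)
  finally show ?thesis
    unfolding norm_exp_eq_Re exp_add [symmetric] by simp
qed

lemma Im_divide_swap_neq_0:
  fixes v w :: complex
  assumes "Im (v / w) \<noteq> 0"
  shows "Im (w / v) \<noteq> 0"
  using assms Reals_inverse [of "w / v"] by (auto simp: complex_is_Real_iff)

text \<open>The coefficient \<open>e\<close> of \<open>1 / v\<close> is fixed on the side and
  \<open>u\<close> runs along it. Then \<open>Im (w * s)\<close> is constant on the side and grows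
  linearly with \<open>n\<close>, while \<open>v * s\<close> moves in direction \<open>v / w\<close>
  from an odd multiple of \<open>pi / 2\<close>. Only a non-zero imaginary part is assumed, so that
  \<open>v\<close> and \<open>w\<close> can be exchanged later.\<close>

lemma H_bound_on_side:
  fixes v w :: complex and a b e :: real
  assumes "w \<noteq> 0" "v \<noteq> 0" and im: "Im (v / w) \<noteq> 0"
    and a: "\<bar>a\<bar> < 1/2" and b: "\<bar>b\<bar> < 1/2" and e: "e \<in> {1, -1}"
  obtains K c where "c > 0" "K \<ge> 0"
    "\<forall>n u s. \<bar>u\<bar> \<le> 1 \<longrightarrow> s = of_real ((real n + 1/2) * pi) * (of_real u / w + of_real e / v) \<longrightarrow>
       sin (w * s) \<noteq> 0 \<and> sin (v * s) \<noteq> 0 \<and>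
       norm (H w v s * exp (2 * \<i> * s * (of_real a * w + of_real b * v)))
         \<le> K * ((real n + 1/2) * pi) * exp (- c * ((real n + 1/2) * pi))"
proof -
  define \<tau> where "\<tau> = v / w"
  obtain k where k: "k > 0" "\<And>t. k * exp \<bar>Im (of_real t * \<tau>)\<bar> \<le> norm (cos (of_real t * \<tau>))"
    using norm_cos_real_multiple_ge_exp_abs_Im im unfolding \<tau>_def by blast
  define d where "d = \<bar>Im (w / v)\<bar>"
  have d: "d > 0"
    using Im_divide_swap_neq_0 [OF im] by (simp add: d_def)
  \<comment> \<open>The sine bound with \<delta> = \<open>d * (pi / 2)\<close>, which is the value
    of \<open>\<bar>Im (w * s)\<bar>\<close> in the worst case \<open>n = 0\<close>.\<close>
  define l where "l = (1 - exp (- 2 * (d * (pi / 2)))) / 2"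
  have l: "l > 0"
    using d by (simp add: l_def)
  define M where "M = norm (inverse w) + norm (inverse v)"
  define K where "K = M / (l * k)"
  define c where "c = (1 - 2 * \<bar>a\<bar>) * d"
  show ?thesis
  proof
    show "c > 0"
      using a d by (simp add: c_def)
    show "K \<ge> 0"
      using l k by (simp add: K_def M_def)
    show "\<forall>n u s. \<bar>u\<bar> \<le> 1 \<longrightarrow> s = of_real ((real n + 1/2) * pi) * (of_real u / w + of_real e / v) \<longrightarrow>
       sin (w * s) \<noteq> 0 \<and> sin (v * s) \<noteq> 0 \<and>
       norm (H w v s * exp (2 * \<i> * s * (of_real a * w + of_real b * v)))
         \<le> K * ((real n + 1/2) * pi) * exp (- c * ((real n + 1/2) * pi))"
    proof (intro allI impI)
      fix n :: nat and u :: real and s :: complex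
      define r where "r = (real n + 1/2) * pi"
      assume u: "\<bar>u\<bar> \<le> 1" and "s = of_real ((real n + 1/2) * pi) * (of_real u / w + of_real e / v)"
      then have s: "s = of_real r * (of_real u / w + of_real e / v)"
        by (simp add: r_def)
      have r: "r \<ge> pi / 2"
        by (simp add: r_def field_simps)
      then have r0: "r > 0"
        using pi_gt_zero by linarith
      have vs: "v * s = of_real (e * r) + of_real (r * u) * \<tau>"
        using assms by (simp add: s \<tau>_def field_simps)
      have ws: "w * s = of_real (r * u) + of_real (e * r) * (w / v)"
        using assms by (simp add: s field_simps)
      define x where "x = \<bar>Im (w * s)\<bar>"
      define y where "y = \<bar>Im (v * s)\<bar>"
      have "Im (of_real x + of_real y * q) = y * Im q" for x y q
        by simp
      then have "Im (w * s) = (e * r) * Im (w / v)"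
        unfolding ws by blast
      then have x: "x = r * d"
        using e r0 by (auto simp: x_def d_def abs_mult)
      have "norm (sin (v * s)) = norm (cos (of_real (r * u) * \<tau>))"
        unfolding vs r_def using norm_sin_half_odd_pi_add [OF e] by blast
      moreover have "y = \<bar>Im (of_real (r * u) * \<tau>)\<bar>"
        by (simp add: y_def vs)
      ultimately have sv: "k * exp y \<le> norm (sin (v * s))"
        using k(2) [of "r * u"] by simp
      have "d * (pi / 2) \<le> x"
        using r d by (simp add: x mult.commute)
      then have sw: "l * exp x \<le> norm (sin (w * s))"
        using norm_sin_ge_exp_abs_Im [of "d * (pi / 2)" "w * s"] by (simp add: l_def x_def)
      have pos: "0 < l * exp x" "0 < k * exp y"
        using l k by simp_all
      have "norm (of_real u / w + of_real e / v) \<le> M"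
      proof -
        have "norm (of_real u / w + of_real e / v) \<le> \<bar>u\<bar> * norm (inverse w) + \<bar>e\<bar> * norm (inverse v)"
          by (rule norm_triangle_le) (simp add: norm_divide divide_inverse norm_mult)
        also have "\<dots> \<le> 1 * norm (inverse w) + 1 * norm (inverse v)"
          using u e by (intro add_mono mult_right_mono) auto
        finally show ?thesis
          by (simp add: M_def)
      qed
      then have ns: "norm s \<le> r * M"
        using r0 by (simp add: s norm_mult)
      have M: "M \<ge> 0"
        by (simp add: M_def)
      have "norm (H w v s) = norm s / (norm (sin (w * s)) * norm (sin (v * s)))"
        by (simp add: H_def norm_divide norm_mult)
      also have "\<dots> \<le> (r * M) / ((l * exp x) * (k * exp y))"
        using ns sw sv pos r0 M k(1)
        by (intro frac_le mult_mono mult_pos_pos [OF pos] mult_nonneg_nonneg) auto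
      finally have h: "norm (H w v s) \<le> (r * M) / ((l * exp x) * (k * exp y))" .
      have "norm (H w v s * exp (2 * \<i> * s * (of_real a * w + of_real b * v)))
              \<le> (r * M) / ((l * exp x) * (k * exp y)) * (exp (2 * \<bar>a\<bar> * x) * exp (2 * \<bar>b\<bar> * y))"
        unfolding norm_mult x_def y_def
        using h norm_exp_cell_le [of s a w b v] r0 M pos
        by (intro mult_mono) (auto simp: x_def y_def)
      also have "\<dots> = K * r * (exp (2 * \<bar>a\<bar> * x) / exp x * (exp (2 * \<bar>b\<bar> * y) / exp y))"
        by (simp add: K_def mult_ac)
      also have "\<dots> = K * r * (exp (- c * r) * exp (- ((1 - 2 * \<bar>b\<bar>) * y)))"
        unfolding exp_diff [symmetric] by (simp add: x c_def algebra_simps)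
      \<comment> \<open>Since \<open>y\<close> vanishes at the midpoint of the side, its factor
        gives no uniform decay and is bounded by 1; the decay comes from \<open>x = r * d\<close>
        alone.\<close>
      also have "\<dots> \<le> K * r * (exp (- c * r) * 1)"
        using \<open>K \<ge> 0\<close> r0 b by (intro mult_left_mono) (auto simp: y_def)
      finally show "sin (w * s) \<noteq> 0 \<and> sin (v * s) \<noteq> 0 \<and>
             norm (H w v s * exp (2 * \<i> * s * (of_real a * w + of_real b * v)))
               \<le> K * ((real n + 1/2) * pi) * exp (- c * ((real n + 1/2) * pi))"
        using sw sv pos by (auto simp: r_def)
    qed
  qed
qed

lemma H_side_integral:
  fixes v w :: complex and a b e d :: real
  defines "F \<equiv> \<lambda>s. H w v s * exp (2 * \<i> * s * (of_real a * w + of_real b * v))"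
  defines "p \<equiv> \<lambda>n d. of_real ((real n + 1/2) * pi) * (of_real d / w + of_real e / v)"
  assumes "w \<noteq> 0" "v \<noteq> 0" "Im (v / w) \<noteq> 0"
    and "\<bar>a\<bar> < 1/2" "\<bar>b\<bar> < 1/2" "e \<in> {1, -1}" and d: "d \<in> {1, -1}"
  shows "F contour_integrable_on linepath (p n d) (p n (- d))"
    and "(\<lambda>n. contour_integral (linepath (p n d) (p n (- d))) F) \<longlonglongrightarrow> 0"
proof -
  obtain K c where c: "c > 0" and K: "K \<ge> 0" and
    "\<forall>n u s. \<bar>u\<bar> \<le> 1 \<longrightarrow> s = of_real ((real n + 1/2) * pi) * (of_real u / w + of_real e / v) \<longrightarrow>
       sin (w * s) \<noteq> 0 \<and> sin (v * s) \<noteq> 0 \<and>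
       norm (H w v s * exp (2 * \<i> * s * (of_real a * w + of_real b * v)))
         \<le> K * ((real n + 1/2) * pi) * exp (- c * ((real n + 1/2) * pi))"
    by (rule H_bound_on_side [OF assms(3-8)]) (rule that)
  then have bound: "sin (w * p n u) \<noteq> 0 \<and> sin (v * p n u) \<noteq> 0 \<and>
      norm (F (p n u)) \<le> K * ((real n + 1/2) * pi) * exp (- c * ((real n + 1/2) * pi))"
    if "\<bar>u\<bar> \<le> 1" for n u
    using that unfolding F_def p_def by blast
  have seg: "\<exists>u. \<bar>u\<bar> \<le> 1 \<and> s = p n u" if s: "s \<in> closed_segment (p n d) (p n (- d))" for s n
  proof -
    obtain t where t: "0 \<le> t" "t \<le> 1" "s = (1 - t) *\<^sub>R p n d + t *\<^sub>R p n (- d)"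
      using s unfolding closed_segment_def by blast
    \<comment> \<open>\<open>p n\<close> is affine in its last argument, and
      \<open>(1 - t) * d + t * (- d)\<close> equals \<open>(1 - 2 * t) * d\<close>.\<close>
    have "s = p n ((1 - 2 * t) * d)"
      unfolding t(3) p_def scaleR_conv_of_real by (simp add: algebra_simps add_divide_distrib diff_divide_distrib)
    moreover have "\<bar>(1 - 2 * t) * d\<bar> \<le> 1"
      using t d by auto
    ultimately show ?thesis
      by blast
  qed
  have nz: "sin (w * s) \<noteq> 0" "sin (v * s) \<noteq> 0"
    and le: "norm (F s) \<le> K * ((real n + 1/2) * pi) * exp (- c * ((real n + 1/2) * pi))"
    if "s \<in> closed_segment (p n d) (p n (- d))" for s n
    using seg [OF that] bound by blast+
  have int: "F contour_integrable_on linepath (p n d) (p n (- d))" for n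
  proof (rule contour_integrable_continuous_linepath)
    show "continuous_on (closed_segment (p n d) (p n (- d))) F"
      unfolding F_def H_def using nz by (intro continuous_intros ballI) auto
  qed
  then show "F contour_integrable_on linepath (p n d) (p n (- d))" .
  \<comment> \<open>One factor \<open>(real n + 1/2) * pi\<close> comes from the bound on the
    integrand, the other from the length of the side.\<close>
  define f where "f = (\<lambda>n::nat. 2 * K * norm (inverse w) *
                        (((real n + 1/2) * pi)\<^sup>2 * exp (- c * ((real n + 1/2) * pi))))"
  have "norm (contour_integral (linepath (p n d) (p n (- d))) F) \<le> f n" for n
  proof -
    have "norm (contour_integral (linepath (p n d) (p n (- d))) F)
            \<le> K * ((real n + 1/2) * pi) * exp (- c * ((real n + 1/2) * pi)) * norm (p n (- d) - p n d)"
      using le K by (intro contour_integral_bound_linepath int) auto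
    also have "p n (- d) - p n d = of_real (- 2 * d * ((real n + 1/2) * pi)) * inverse w"
    proof -
      have "of_real x * (of_real (- d) / w + of_real e / v) - of_real x * (of_real d / w + of_real e / v)
              = of_real (- 2 * d * x) * inverse w" for x
        by (simp add: algebra_simps divide_inverse)
      then show ?thesis
        unfolding p_def by blast
    qed
    also have "norm \<dots> = 2 * ((real n + 1/2) * pi) * norm (inverse w)"
      unfolding norm_mult norm_of_real using d by (auto simp: abs_mult)
    finally show ?thesis
      by (simp only: f_def power2_eq_square mult_ac)
  qed
  then have "\<forall>\<^sub>F n in sequentially. norm (contour_integral (linepath (p n d) (p n (- d))) F) \<le> f n"
    by simp
  moreover have "(\<lambda>n. ((real n + 1/2) * pi)\<^sup>2 * exp (- c * ((real n + 1/2) * pi))) \<longlonglongrightarrow> 0"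
    using c by real_asymp
  then have "f \<longlonglongrightarrow> 0"
    unfolding f_def by (rule tendsto_mult_right_zero)
  ultimately show "(\<lambda>n. contour_integral (linepath (p n d) (p n (- d))) F) \<longlonglongrightarrow> 0"
    by (rule Lim_null_comparison)
qed

section \<open>Summation over the four sides\<close>

theorem mainTheorem1:
  fixes \<omega>1 \<omega>2 z :: complex
  assumes "\<omega>1 \<noteq> 0" and "\<omega>2 \<noteq> 0"
    and "Im (\<omega>2 / \<omega>1) > 0"
    and "z \<in> open_cell \<omega>1 \<omega>2"
  shows "(\<lambda>n. contour_integral (C \<omega>1 \<omega>2 n) (\<lambda>s. H \<omega>1 \<omega>2 s * exp (2 * \<i> * s * z)))
           \<longlonglongrightarrow> 0"
proof -
  obtain a b where z: "z = of_real a * \<omega>1 + of_real b * \<omega>2" and ab: "\<bar>a\<bar> < 1/2" "\<bar>b\<bar> < 1/2"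
    using assms(4) by (auto simp: open_cell_def abs_less_iff)
  have im: "Im (\<omega>2 / \<omega>1) \<noteq> 0"
    using assms by simp
  note im' = Im_divide_swap_neq_0 [OF im]
  \<comment> \<open>The integrand is invariant under exchanging \<open>\<omega>1\<close>,
    \<open>a\<close> with \<open>\<omega>2\<close>, \<open>b\<close>. The side estimate thus also
    covers the two sides on which the coefficient of \<open>1 / \<omega>1\<close> is fixed.\<close>
  have sym: "H \<omega>2 \<omega>1 s * exp (2 * \<i> * s * (of_real b * \<omega>2 + of_real a * \<omega>1))
               = H \<omega>1 \<omega>2 s * exp (2 * \<i> * s * z)" for s
    by (simp add: H_def z mult.commute add.commute)
  define F where "F = (\<lambda>s. H \<omega>1 \<omega>2 s * exp (2 * \<i> * s * z))"
  \<comment> \<open>For signs \<open>d\<close> and \<open>e\<close> these are the four vertices;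
    each side flips exactly one sign.\<close>
  define P where "P = (\<lambda>n d e. of_real ((real n + 1/2) * pi) *
                         (of_real d / \<omega>1 + of_real e / \<omega>2) :: complex)"
  have side1: "F contour_integrable_on linepath (P n d e) (P n (- d) e)"
      "(\<lambda>n. contour_integral (linepath (P n d e) (P n (- d) e)) F) \<longlonglongrightarrow> 0"
    if "e \<in> {1, -1}" "d \<in> {1, -1}" for n d e
    unfolding F_def P_def z by (rule H_side_integral [OF assms(1,2) im ab that])+
  have side2: "F contour_integrable_on linepath (P n d e) (P n d (- e))"
      "(\<lambda>n. contour_integral (linepath (P n d e) (P n d (- e))) F) \<longlonglongrightarrow> 0"
    if "d \<in> {1, -1}" "e \<in> {1, -1}" for n d e
    unfolding F_def P_def sym [symmetric] add.commute [of "of_real d / \<omega>1"]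
    by (rule H_side_integral [OF assms(2,1) im' ab(2,1) that])+
  have int: "F contour_integrable_on linepath (P n 1 (-1)) (P n (-1) (-1))"
    "F contour_integrable_on linepath (P n (-1) (-1)) (P n (-1) 1)"
    "F contour_integrable_on linepath (P n (-1) 1) (P n 1 1)"
    "F contour_integrable_on linepath (P n 1 1) (P n 1 (-1))" for n
    using side1(1) [of "-1" 1 n] side2(1) [of "-1" "-1" n] side1(1) [of 1 "-1" n] side2(1) [of 1 1 n]
    unfolding minus_minus by blast+
  have C: "C \<omega>1 \<omega>2 n = linepath (P n 1 (-1)) (P n (-1) (-1)) +++ linepath (P n (-1) (-1)) (P n (-1) 1)
             +++ linepath (P n (-1) 1) (P n 1 1) +++ linepath (P n 1 1) (P n 1 (-1))" for n
    by (simp add: C_def P_def Let_def inverse_eq_divide minus_diff_commute)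
  have "contour_integral (C \<omega>1 \<omega>2 n) F
          = contour_integral (linepath (P n 1 (-1)) (P n (-1) (-1))) F
          + (contour_integral (linepath (P n (-1) (-1)) (P n (-1) 1)) F
          + (contour_integral (linepath (P n (-1) 1) (P n 1 1)) F
          + contour_integral (linepath (P n 1 1) (P n 1 (-1))) F))" for n
    unfolding C by (simp add: int contour_integrable_join)
  moreover have "(\<lambda>n. contour_integral (linepath (P n 1 (-1)) (P n (-1) (-1))) F
          + (contour_integral (linepath (P n (-1) (-1)) (P n (-1) 1)) F
          + (contour_integral (linepath (P n (-1) 1) (P n 1 1)) F
          + contour_integral (linepath (P n 1 1) (P n 1 (-1))) F))) \<longlonglongrightarrow> 0"
    using side1(2) [of "-1" 1] side2(2) [of "-1" "-1"] side1(2) [of 1 "-1"] side2(2) [of 1 1]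
    by (intro tendsto_add_zero) simp_all
  ultimately show ?thesis
    by (simp add: F_def)
qed

end
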